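(* Let $(\mathfrak g,B)$ be a Rota-Baxter Lie algebra of weight $-1$, let $\widetilde B=\mathrm{id}-B$, and let $(\mathfrak g_+,\mathfrak g_-,\rhd,\blacktriangleright)$ be the matched pair of Lie algebras on $(\mathfrak g,B)$, with bicrossed product $\mathfrak g_+\bowtie\mathfrak g_-$. Then the operators $C,\widetilde C:\mathfrak g_+\bowtie\mathfrak g_-\to\mathfrak g_+\bowtie\mathfrak g_-$ given, for all $x_1,x_2\in\mathfrak g$, by $$C\big((B(x_1),\widetilde B(x_2))\big)=\big(B(B(x_1)+\widetilde B(x_2)),\ \widetilde B(B(x_1)+\widetilde B(x_2))\big),$$ $$\widetilde C\big((B(x_1),\widetilde B(x_2))\big)=\big(B\circ\widetilde B(x_1-x_2),\ -\widetilde B\circ B(x_1-x_2)\big)$$ are (well defined) Lie algebra projections on $(\mathfrak g_+,\mathfrak g_-,\rhd,\blacktriangleright)$ such that $C+\widetilde C=\mathrm{id}_{\mathfrak g_+\bowtie\mathfrak g_-}$.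
   Context: Lie algebras are over a field $\mathbb K$. A Rota-Baxter operator of weight $\lambda$ on a Lie algebra $\mathfrak g$ is a linear map $B:\mathfrak g\to\mathfrak g$ with $[B(x),B(y)]=B([B(x),y]+[x,B(y)]+\lambda[x,y])$ for all $x,y$; $(\mathfrak g,B)$ is then a Rota-Baxter Lie algebra of weight $\lambda$. For $(\mathfrak g,B)$ of weight $-1$ put $\widetilde B=\mathrm{id}-B$, $\mathfrak g_+=\mathrm{Im}\,B$, $\mathfrak g_-=\mathrm{Im}\,\widetilde B$ (Lie subalgebras of $\mathfrak g$). The matched pair of Lie algebras on $(\mathfrak g,B)$ is $(\mathfrak g_+,\mathfrak g_-,\rhd,\blacktriangleright)$ with the well-defined maps $B(x)\rhd\widetilde B(y)=\widetilde B([B(x),y])$ and $\widetilde B(x)\blacktriangleright B(y)=B([\widetilde B(x),y])$. Its bicrossed product $\mathfrak g_+\bowtie\mathfrak g_-$ is the (external) vector space direct sum $\mathfrak g_+\oplus\mathfrak g_-$ with the Lie bracket $$[(x,u),(y,v)]_{\bowtie}=\big([x,y]+u\blacktriangleright y-v\blacktriangleright x,\ [u,v]+x\rhd v-y\rhd u\big).$$ A Lie algebra projection on a matched pair $(\mathfrak g_+,\mathfrak g_-,\rhd,\blacktriangleright)$ is an idempotent Lie algebra homomorphism $\mathfrak g_+\bowtie\mathfrak g_-\to\mathfrak g_+\bowtie\mathfrak g_-$. *)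

theory Defs
  imports "HOL-Analysis.Product_Vector"
begin

section \<open>Lie algebras on a subspace of an ambient vector space\<close>

text \<open>The carrier \<open>S\<close> is a subspace of an ambient vector space, so that images of operators and
  their external direct sums are Lie algebras in the same sense as the whole space (\<open>S = UNIV\<close>).
  The bracket is only constrained on \<open>S\<close>.\<close>

locale lie_algebra_on = vector_space smul
  for smul :: "'k::field \<Rightarrow> 'v::ab_group_add \<Rightarrow> 'v" +
  fixes S :: "'v set" and bracket :: "'v \<Rightarrow> 'v \<Rightarrow> 'v"
  assumes subspace_carrier: "subspace S"
    and bracket_closed: "\<lbrakk>x \<in> S; y \<in> S\<rbrakk> \<Longrightarrow> bracket x y \<in> S"
    and bracket_add_left:
      "\<lbrakk>x \<in> S; y \<in> S; z \<in> S\<rbrakk> \<Longrightarrow> bracket (x + y) z = bracket x z + bracket y z"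
    and bracket_add_right:
      "\<lbrakk>x \<in> S; y \<in> S; z \<in> S\<rbrakk> \<Longrightarrow> bracket x (y + z) = bracket x y + bracket x z"
    and bracket_scale_left:
      "\<lbrakk>x \<in> S; y \<in> S\<rbrakk> \<Longrightarrow> bracket (smul c x) y = smul c (bracket x y)"
    and bracket_scale_right:
      "\<lbrakk>x \<in> S; y \<in> S\<rbrakk> \<Longrightarrow> bracket x (smul c y) = smul c (bracket x y)"
    and bracket_self: "x \<in> S \<Longrightarrow> bracket x x = 0"
    and jacobi:
      "\<lbrakk>x \<in> S; y \<in> S; z \<in> S\<rbrakk> \<Longrightarrow>
        bracket x (bracket y z) + bracket y (bracket z x) + bracket z (bracket x y) = 0"

locale lie_algebra_hom =
  dom: lie_algebra_on scale1 S1 bracket1 + cod: lie_algebra_on scale2 S2 bracket2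
  for scale1 :: "'k::field \<Rightarrow> 'v::ab_group_add \<Rightarrow> 'v" and S1 bracket1
    and scale2 :: "'k \<Rightarrow> 'w::ab_group_add \<Rightarrow> 'w" and S2 bracket2 +
  fixes f :: "'v \<Rightarrow> 'w"
  assumes hom_closed: "x \<in> S1 \<Longrightarrow> f x \<in> S2"
    and hom_add: "\<lbrakk>x \<in> S1; y \<in> S1\<rbrakk> \<Longrightarrow> f (x + y) = f x + f y"
    and hom_scale: "x \<in> S1 \<Longrightarrow> f (scale1 c x) = scale2 c (f x)"
    and hom_bracket: "\<lbrakk>x \<in> S1; y \<in> S1\<rbrakk> \<Longrightarrow> f (bracket1 x y) = bracket2 (f x) (f y)"


section \<open>Rota--Baxter Lie algebras\<close>

locale rota_baxter_lie_algebra = lie_algebra_on smul UNIV bracket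
  for smul :: "'k::field \<Rightarrow> 'g::ab_group_add \<Rightarrow> 'g" and bracket +
  fixes weight :: 'k and B :: "'g \<Rightarrow> 'g"
  assumes linear_B: "Vector_Spaces.linear smul smul B"
    and rota_baxter:
      "bracket (B x) (B y) = B (bracket (B x) y + bracket x (B y) + smul weight (bracket x y))"

definition rb_compl :: "('g::ab_group_add \<Rightarrow> 'g) \<Rightarrow> 'g \<Rightarrow> 'g" where
  "rb_compl B x = x - B x"


section \<open>The matched pair on a Rota--Baxter Lie algebra of weight -1\<close>

text \<open>The two actions are prescribed on representatives, and the unique value is picked by a
  definite description. Independence of the representatives is shown in \<open>rb_act_plus_eq\<close> and
  \<open>rb_act_minus_eq\<close> below.\<close>

definition rb_act_plus ::
  "('g::ab_group_add \<Rightarrow> 'g \<Rightarrow> 'g) \<Rightarrow> ('g \<Rightarrow> 'g) \<Rightarrow> 'g \<Rightarrow> 'g \<Rightarrow> 'g" where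
  "rb_act_plus bracket B a u =
    (THE w. \<exists>x y. a = B x \<and> u = rb_compl B y \<and> w = rb_compl B (bracket (B x) y))"

definition rb_act_minus ::
  "('g::ab_group_add \<Rightarrow> 'g \<Rightarrow> 'g) \<Rightarrow> ('g \<Rightarrow> 'g) \<Rightarrow> 'g \<Rightarrow> 'g \<Rightarrow> 'g" where
  "rb_act_minus bracket B u a =
    (THE w. \<exists>x y. u = rb_compl B x \<and> a = B y \<and> w = B (bracket (rb_compl B x) y))"

text \<open>In the following, \<open>act1 x v\<close> is the action of the first algebra on the second one, and
  \<open>act2 u y\<close> the action of the second algebra on the first one.\<close>

definition bicrossed_bracket ::
  "('v::ab_group_add \<Rightarrow> 'v \<Rightarrow> 'v) \<Rightarrow> ('w::ab_group_add \<Rightarrow> 'w \<Rightarrow> 'w) \<Rightarrow>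
   ('v \<Rightarrow> 'w \<Rightarrow> 'w) \<Rightarrow> ('w \<Rightarrow> 'v \<Rightarrow> 'v) \<Rightarrow> 'v \<times> 'w \<Rightarrow> 'v \<times> 'w \<Rightarrow> 'v \<times> 'w" where
  "bicrossed_bracket br1 br2 act1 act2 = (\<lambda>(x, u) (y, v).
    (br1 x y + act2 u y - act2 v x, br2 u v + act1 x v - act1 y u))"

definition rb_bicrossed_carrier :: "('g::ab_group_add \<Rightarrow> 'g) \<Rightarrow> ('g \<times> 'g) set" where
  "rb_bicrossed_carrier B = range B \<times> range (rb_compl B)"

definition rb_bicrossed_bracket ::
  "('g::ab_group_add \<Rightarrow> 'g \<Rightarrow> 'g) \<Rightarrow> ('g \<Rightarrow> 'g) \<Rightarrow> 'g \<times> 'g \<Rightarrow> 'g \<times> 'g \<Rightarrow> 'g \<times> 'g" where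
  "rb_bicrossed_bracket bracket B =
    bicrossed_bracket bracket bracket (rb_act_plus bracket B) (rb_act_minus bracket B)"

definition rb_lie_projection ::
  "('k::field \<Rightarrow> 'g::ab_group_add \<Rightarrow> 'g) \<Rightarrow> ('g \<Rightarrow> 'g \<Rightarrow> 'g) \<Rightarrow> ('g \<Rightarrow> 'g) \<Rightarrow>
   ('g \<times> 'g \<Rightarrow> 'g \<times> 'g) \<Rightarrow> bool" where
  "rb_lie_projection smul bracket B f \<longleftrightarrow>
    lie_algebra_hom
      (module_prod.scale smul smul) (rb_bicrossed_carrier B) (rb_bicrossed_bracket bracket B)
      (module_prod.scale smul smul) (rb_bicrossed_carrier B) (rb_bicrossed_bracket bracket B) f \<and>
    (\<forall>p \<in> rb_bicrossed_carrier B. f (f p) = f p)"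


section \<open>The actions are well defined\<close>

lemma (in lie_algebra_on) bracket_diff_right:
  assumes "x \<in> S" "y \<in> S" "z \<in> S"
  shows "bracket x (y - z) = bracket x y - bracket x z"
proof -
  have "y - z \<in> S"
    using assms subspace_carrier subspace_diff by blast
  then have "bracket x (y - z + z) = bracket x (y - z) + bracket x z"
    using assms bracket_add_right by blast
  then show ?thesis by simp
qed

lemma rb_act_plus_eq:
  assumes "rota_baxter_lie_algebra smul bracket (- 1) B"
  shows "rb_act_plus bracket B (B x) (rb_compl B y) = rb_compl B (bracket (B x) y)"
proof -
  interpret rota_baxter_lie_algebra smul bracket "- 1" B by fact
  interpret B: Vector_Spaces.linear smul smul B by (rule linear_B)
  have key: "rb_compl B (bracket (B x) d) = 0" if "B d = d" for d
    using rota_baxter[of x d] that by (simp add: rb_compl_def scale_minus_left)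
  have "rb_compl B (bracket (B x) y') = rb_compl B (bracket (B x) y)"
    if "rb_compl B y = rb_compl B y'" for y'
  proof -
    have "B (y' - y) = y' - y"
      using that by (simp add: rb_compl_def B.diff algebra_simps)
    from key[OF this] show ?thesis
      by (simp add: rb_compl_def bracket_diff_right B.diff algebra_simps)
  qed
  note indep = this
  show ?thesis
    unfolding rb_act_plus_def
  proof (rule the_equality)
    fix w
    assume "\<exists>x' y'. B x = B x' \<and> rb_compl B y = rb_compl B y' \<and>
      w = rb_compl B (bracket (B x') y')"
    then show "w = rb_compl B (bracket (B x) y)"
      using indep by metis
  qed (rule exI[of _ x], rule exI[of _ y], simp)
qed

lemma rb_act_minus_eq:
  assumes "rota_baxter_lie_algebra smul bracket (- 1) B"
  shows "rb_act_minus bracket B (rb_compl B x) (B y) = B (bracket (rb_compl B x) y)"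
proof -
  interpret rota_baxter_lie_algebra smul bracket "- 1" B by fact
  interpret B: Vector_Spaces.linear smul smul B by (rule linear_B)
  have key: "B (bracket (rb_compl B x) d) = 0" if "B d = 0" for d
  proof -
    have "bracket (x - B x) d + bracket (B x) d = bracket x d"
      using bracket_add_left[of "x - B x" "B x" d] by simp
    then have "bracket (rb_compl B x) d = bracket x d - bracket (B x) d"
      by (simp add: rb_compl_def eq_diff_eq)
    moreover have "bracket (B x) 0 = 0" "bracket x 0 = 0"
      using bracket_diff_right[of _ 0 0] by auto
    then have "B (bracket (B x) d) - B (bracket x d) = 0"
      using rota_baxter[of x d] that by (simp add: B.diff)
    ultimately show ?thesis
      by (simp add: B.diff)
  qed
  have "B (bracket (rb_compl B x) y') = B (bracket (rb_compl B x) y)" if "B y = B y'" for y'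
    using key[of "y' - y"] that by (simp add: bracket_diff_right B.diff)
  note indep = this
  show ?thesis
    unfolding rb_act_minus_def
  proof (rule the_equality)
    fix w
    assume "\<exists>x' y'. rb_compl B x = rb_compl B x' \<and> B y = B y' \<and>
      w = B (bracket (rb_compl B x') y')"
    then show "w = B (bracket (rb_compl B x) y)"
      using indep by metis
  qed (rule exI[of _ x], rule exI[of _ y], simp)
qed

end

theory Submission
  imports Defs
begin

text \<open>
  Write \<open>B\<close> for the operator, \<open>B'\<close> for \<open>id - B\<close>, and \<open>[d, e]\<^sub>B = [B d, e] + [d, B e] - [d, e]\<close> for
  the descendent bracket, so that the Rota--Baxter identity reads \<open>B [d, e]\<^sub>B = [B d, B e]\<close>.
  The idea is that the bicrossed product is a quotient of the direct product of the Lie algebra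
  \<open>\<gg>\<close> with its descendent Lie algebra, in such a way that \<open>C\<close> and \<open>C'\<close> are induced by the two
  factor projections.

  A pair \<open>(B x, B' y)\<close> is determined by \<open>s = B x + B' y\<close> and \<open>d = x - y\<close>, since
  \<open>x = s + B' d\<close> and \<open>y = s - B d\<close>. Conversely every \<open>(s, d)\<close> arises. In these
  coordinates the bracket of the bicrossed product is
  \<open>((s, d), (t, e)) \<mapsto> ([s, t], [d, e]\<^sub>B)\<close> (lemma \<open>bracket_coords\<close>), and the
  two operators are \<open>(s, d) \<mapsto> (s, 0)\<close> and \<open>(s, d) \<mapsto> (0, d)\<close>. The coordinate map is not
  injective (\<open>d\<close> matters only modulo the kernel of \<open>B B'\<close>), but it is linear and surjective, and
  this suffices to transport the Lie algebra axioms and the homomorphism property: the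
  Jacobi identity for the descendent bracket is only required after applying \<open>B\<close>, where it is
  the Jacobi identity of \<open>\<gg>\<close>.
\<close>


section \<open>The descendent bracket\<close>

locale rota_baxter_minus_one = rota_baxter_lie_algebra smul bracket "- 1" B
  for smul :: "'k::field \<Rightarrow> 'g::ab_group_add \<Rightarrow> 'g" and bracket B
begin

sublocale B: Vector_Spaces.linear smul smul B
  by (rule linear_B)

abbreviation B' :: "'g \<Rightarrow> 'g" where
  "B' \<equiv> rb_compl B"

abbreviation scale_pair :: "'k \<Rightarrow> 'g \<times> 'g \<Rightarrow> 'g \<times> 'g" where
  "scale_pair \<equiv> module_prod.scale smul smul"

abbreviation carrier :: "('g \<times> 'g) set" where
  "carrier \<equiv> rb_bicrossed_carrier B"

abbreviation bicrossed :: "'g \<times> 'g \<Rightarrow> 'g \<times> 'g \<Rightarrow> 'g \<times> 'g" where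
  "bicrossed \<equiv> rb_bicrossed_bracket bracket B"

definition descendent_bracket :: "'g \<Rightarrow> 'g \<Rightarrow> 'g" where
  "descendent_bracket d e = bracket (B d) e + bracket d (B e) - bracket d e"

lemma bracket_linear:
  "bracket (x + y) z = bracket x z + bracket y z"
  "bracket z (x + y) = bracket z x + bracket z y"
  "bracket (smul c x) z = smul c (bracket x z)"
  "bracket z (smul c x) = smul c (bracket z x)"
  by (simp_all add: bracket_add_left bracket_add_right bracket_scale_left bracket_scale_right)

lemma bracket_diff:
  "bracket (x - y) z = bracket x z - bracket y z"
  "bracket z (x - y) = bracket z x - bracket z y"
  using bracket_linear(1)[of "x - y" y z] bracket_linear(2)[of z "x - y" y]
  by (simp_all add: eq_diff_eq)

lemma bracket_anticomm: "bracket x y = - bracket y x"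
proof -
  have "bracket (x + y) (x + y) = bracket x y + bracket y x"
    by (simp only: bracket_linear) (simp add: bracket_self)
  then have "bracket x y + bracket y x = 0"
    by (simp add: bracket_self)
  then show ?thesis
    by (simp add: eq_neg_iff_add_eq_0)
qed

lemma B_descendent_bracket: "B (descendent_bracket d e) = bracket (B d) (B e)"
  unfolding descendent_bracket_def using rota_baxter[of d e] by (simp add: scale_minus_left)

lemma B_compl_commute: "B (B' x) = B' (B x)"
  by (simp add: rb_compl_def B.diff)

lemma compl_linear:
  "B' (x + y) = B' x + B' y" "B' (x - y) = B' x - B' y" "B' (smul c x) = smul c (B' x)"
  "B' (- x) = - B' x"
  by (simp_all add: rb_compl_def B.add B.diff B.scale B.neg scale_right_diff_distrib)

text \<open>Both \<open>B\<close> and \<open>B - id\<close> are homomorphisms for the descendent bracket; the symmetry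
  \<open>B \<leftrightarrow> B'\<close> changes the sign of that bracket.\<close>

lemma compl_descendent_bracket: "B' (descendent_bracket d e) = - bracket (B' d) (B' e)"
proof -
  have "B' (descendent_bracket d e) = descendent_bracket d e - bracket (B d) (B e)"
    by (simp add: rb_compl_def B_descendent_bracket)
  then show ?thesis
    by (simp add: rb_compl_def descendent_bracket_def bracket_diff algebra_simps)
qed

lemma descendent_bracket_linear:
  "descendent_bracket (d + d') e = descendent_bracket d e + descendent_bracket d' e"
  "descendent_bracket e (d + d') = descendent_bracket e d + descendent_bracket e d'"
  "descendent_bracket (smul c d) e = smul c (descendent_bracket d e)"
  "descendent_bracket e (smul c d) = smul c (descendent_bracket e d)"
  by (simp_all add: descendent_bracket_def B.add B.scale bracket_linear
      scale_right_diff_distrib scale_right_distrib algebra_simps)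

lemma descendent_bracket_self: "descendent_bracket d d = 0"
  using bracket_anticomm[of "B d" d] by (simp add: descendent_bracket_def bracket_self)

lemma descendent_bracket_zero: "descendent_bracket 0 e = 0" "descendent_bracket e 0 = 0"
  using descendent_bracket_linear(1)[of 0 0 e] descendent_bracket_linear(2)[of e 0 0] by auto

lemma bracket_zero: "bracket 0 x = 0" "bracket x 0 = 0"
  using bracket_linear(1)[of 0 0 x] bracket_linear(2)[of x 0 0] by auto


section \<open>Coordinates on the bicrossed product\<close>

definition coords :: "'g \<Rightarrow> 'g \<Rightarrow> 'g \<times> 'g" where
  "coords s d = (B (s + B' d), B' (s - B d))"

lemma pair_eq_coords: "(B x, B' y) = coords (B x + B' y) (x - y)"
proof -
  have "B x + B' y + B' (x - y) = x" "B x + B' y - B (x - y) = y"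
    by (simp_all add: rb_compl_def B.diff)
  then show ?thesis
    by (simp add: coords_def)
qed

lemma carrier_eq_coords: "carrier = {coords s d | s d. True}"
proof -
  have "p \<in> carrier \<Longrightarrow> \<exists>s d. p = coords s d" for p
    unfolding rb_bicrossed_carrier_def using pair_eq_coords by fast
  moreover have "coords s d \<in> carrier" for s d
    by (simp add: coords_def rb_bicrossed_carrier_def)
  ultimately show ?thesis
    by blast
qed

lemma carrierE:
  assumes "p \<in> carrier"
  obtains s d where "p = coords s d"
  using assms unfolding carrier_eq_coords by blast

lemma coords_in_carrier: "coords s d \<in> carrier"
  unfolding carrier_eq_coords by blast

lemma sum_coords: "fst (coords s d) + snd (coords s d) = s"
  by (simp add: coords_def rb_compl_def B.add B.diff)

lemma coords_add: "coords s d + coords t e = coords (s + t) (d + e)"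
  by (simp add: coords_def B.add B.diff compl_linear algebra_simps)

lemma scale_pair_Pair: "scale_pair c (a, b) = (smul c a, smul c b)"
proof -
  interpret module_pair smul smul ..
  interpret module_prod smul smul ..
  show ?thesis by (simp add: scale_def)
qed

lemma coords_scale: "scale_pair c (coords s d) = coords (smul c s) (smul c d)"
  by (simp add: coords_def scale_pair_Pair B.add B.diff B.scale compl_linear
      scale_right_diff_distrib scale_right_distrib)

lemma coords_eq_zero: "B d = 0 \<Longrightarrow> coords 0 d = 0"
  by (simp add: coords_def B_compl_commute) (simp add: rb_compl_def zero_prod_def)

text \<open>On representatives \<open>x, x'\<close> and \<open>y, y'\<close> with sums \<open>s = B x + B' y\<close> and \<open>t = B x' + B' y'\<close>, the
  Rota--Baxter identities for \<open>B\<close> and \<open>B'\<close> turn the two components of the bracket into the images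
  under \<open>B\<close> and \<open>B'\<close> of \<open>[s, x'] + [x, t] - [x, x']\<close> and
  \<open>[s, y'] + [y, t] - [y, y']\<close>. These elements are \<open>[s, t] - [s - x, t - x']\<close> and
  \<open>[s, t] - [s - y, t - y']\<close>, where the shifts \<open>x - s = B' d\<close> and \<open>s - y = B d\<close> turn the second
  terms into images of the descendent bracket.\<close>

lemma bracket_coords:
  "bicrossed (coords s d) (coords t e) = coords (bracket s t) (descendent_bracket d e)"
proof -
  define x y x' y' where xy: "x = s + B' d" "y = s - B d" "x' = t + B' e" "y' = t - B e"
  have s: "s = B x + B' y" and t: "t = B x' + B' y'"
    by (simp_all add: xy rb_compl_def B.add B.diff)
  have rb: "rota_baxter_lie_algebra smul bracket (- 1) B" ..
  have compl_rb: "bracket (B' y) (B' y') = B' (bracket (B' y) y' + bracket y (B' y') - bracket y y')"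
  proof -
    have "bracket (B' y) y' + bracket y (B' y') - bracket y y' = - descendent_bracket y y'"
      by (simp add: descendent_bracket_def rb_compl_def bracket_diff)
    then show ?thesis
      by (simp add: compl_descendent_bracket compl_linear)
  qed
  have comp1: "bracket (B x) (B x') + B (bracket (B' y) x') - B (bracket (B' y') x)
    = B (bracket s x' + bracket x t - bracket x x')"
    using bracket_anticomm[of "B' y'" x]
    by (simp add: s t B_descendent_bracket[symmetric] descendent_bracket_def bracket_linear
        B.add B.diff B.neg algebra_simps)
  have comp2: "bracket (B' y) (B' y') + B' (bracket (B x) y') - B' (bracket (B x') y)
    = B' (bracket s y' + bracket y t - bracket y y')"
    using bracket_anticomm[of "B x'" y]
    by (simp add: compl_rb s t bracket_linear compl_linear algebra_simps)
  have shift1: "bracket s x' + bracket x t - bracket x x'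
    = bracket s t + B' (descendent_bracket d e)"
    by (simp add: xy compl_descendent_bracket bracket_linear algebra_simps)
  have shift2: "bracket s y' + bracket y t - bracket y y'
    = bracket s t - B (descendent_bracket d e)"
    by (simp add: xy B_descendent_bracket bracket_diff algebra_simps)
  have "coords s d = (B x, B' y)" "coords t e = (B x', B' y')"
    by (simp_all add: coords_def xy)
  then show ?thesis
    using comp1 comp2 shift1 shift2
    by (simp add: rb_bicrossed_bracket_def bicrossed_bracket_def coords_def
        rb_act_plus_eq[OF rb] rb_act_minus_eq[OF rb])
qed


section \<open>The bicrossed product and its projections\<close>

text \<open>The factor for the descendent bracket satisfies the Jacobi identity modulo the kernel of
  \<open>B\<close>, which the coordinate map annihilates.\<close>

lemma bicrossed_lie_algebra: "lie_algebra_on scale_pair carrier bicrossed"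
proof -
  interpret P: vector_space scale_pair
    by unfold_locales
      (auto simp: scale_pair_Pair scale_right_distrib scale_left_distrib)
  have zero: "(0 :: 'g \<times> 'g) = coords 0 0"
    by (simp add: coords_eq_zero)
  show ?thesis
  proof
    show "P.subspace carrier"
      unfolding P.subspace_def
      by (metis carrierE coords_add coords_in_carrier coords_scale zero)
  next
    fix p q assume "p \<in> carrier" "q \<in> carrier"
    then show "bicrossed p q \<in> carrier"
      by (metis carrierE bracket_coords coords_in_carrier)
  next
    fix p q r assume "p \<in> carrier" "q \<in> carrier" "r \<in> carrier"
    then obtain s d t e u f where [simp]: "p = coords s d" "q = coords t e" "r = coords u f"
      by (metis carrierE)
    show "bicrossed (p + q) r = bicrossed p r + bicrossed q r"
      by (simp add: coords_add bracket_coords bracket_linear descendent_bracket_linear)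
    show "bicrossed p (q + r) = bicrossed p q + bicrossed p r"
      by (simp add: coords_add bracket_coords bracket_linear descendent_bracket_linear)
    have "B (descendent_bracket d (descendent_bracket e f)
      + descendent_bracket e (descendent_bracket f d)
      + descendent_bracket f (descendent_bracket d e)) = 0"
      by (simp add: B.add B_descendent_bracket jacobi)
    then show "bicrossed p (bicrossed q r) + bicrossed q (bicrossed r p)
      + bicrossed r (bicrossed p q) = 0"
      by (simp add: bracket_coords coords_add jacobi coords_eq_zero)
  next
    fix p q c assume "p \<in> carrier" "q \<in> carrier"
    then obtain s d t e where [simp]: "p = coords s d" "q = coords t e"
      by (metis carrierE)
    show "bicrossed (scale_pair c p) q = scale_pair c (bicrossed p q)"
      by (simp add: coords_scale bracket_coords bracket_linear descendent_bracket_linear)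
    show "bicrossed p (scale_pair c q) = scale_pair c (bicrossed p q)"
      by (simp add: coords_scale bracket_coords bracket_linear descendent_bracket_linear)
  next
    fix p assume "p \<in> carrier"
    then show "bicrossed p p = 0"
      by (metis carrierE bracket_coords bracket_self descendent_bracket_self UNIV_I zero)
  qed
qed

text \<open>Coordinates are not unique, so a map on coordinates need not descend to the carrier. Hence \<open>f\<close>
  is given on the carrier first, and \<open>\<sigma>\<close> and \<open>\<delta>\<close> merely lift it to the direct product of
  \<open>\<gg>\<close> with its descendent Lie algebra, where idempotent endomorphisms are visible factorwise.\<close>

lemma lie_projectionI:
  assumes f: "\<And>s d. f (coords s d) = coords (\<sigma> s) (\<delta> d)"
    and add: "\<And>s t. \<sigma> (s + t) = \<sigma> s + \<sigma> t" "\<And>d e. \<delta> (d + e) = \<delta> d + \<delta> e"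
    and scale: "\<And>c s. \<sigma> (smul c s) = smul c (\<sigma> s)" "\<And>c d. \<delta> (smul c d) = smul c (\<delta> d)"
    and bracket: "\<And>s t. \<sigma> (bracket s t) = bracket (\<sigma> s) (\<sigma> t)"
      "\<And>d e. \<delta> (descendent_bracket d e) = descendent_bracket (\<delta> d) (\<delta> e)"
    and idem: "\<And>s. \<sigma> (\<sigma> s) = \<sigma> s" "\<And>d. \<delta> (\<delta> d) = \<delta> d"
  shows "rb_lie_projection smul bracket B f"
proof -
  interpret L: lie_algebra_on scale_pair carrier bicrossed
    by (rule bicrossed_lie_algebra)
  have "lie_algebra_hom scale_pair carrier bicrossed scale_pair carrier bicrossed f"
    by unfold_locales
      (auto elim!: carrierE simp: f coords_in_carrier coords_add coords_scale bracket_coords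
        add scale bracket)
  moreover have "\<forall>p\<in>carrier. f (f p) = f p"
    by (auto elim!: carrierE simp: f idem)
  ultimately show ?thesis
    by (simp add: rb_lie_projection_def)
qed

end

theorem theorem2p12:
  fixes smul :: "'k::field \<Rightarrow> 'g::ab_group_add \<Rightarrow> 'g"
    and bracket :: "'g \<Rightarrow> 'g \<Rightarrow> 'g"
    and B :: "'g \<Rightarrow> 'g"
  assumes "rota_baxter_lie_algebra smul bracket (- 1) B"
  shows "\<exists>C C'.
    (\<forall>x1 x2. C (B x1, rb_compl B x2) =
      (B (B x1 + rb_compl B x2), rb_compl B (B x1 + rb_compl B x2))) \<and>
    (\<forall>x1 x2. C' (B x1, rb_compl B x2) =
      (B (rb_compl B (x1 - x2)), - rb_compl B (B (x1 - x2)))) \<and>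
    rb_lie_projection smul bracket B C \<and>
    rb_lie_projection smul bracket B C' \<and>
    (\<forall>p \<in> rb_bicrossed_carrier B. C p + C' p = p)"
proof -
  interpret rota_baxter_minus_one smul bracket B
    using assms by (simp add: rota_baxter_minus_one_def)
  define C where "C p = coords (fst p + snd p) 0" for p
  define C' where "C' p = p - C p" for p
  \<comment> \<open>\<open>C\<close> and \<open>C'\<close> are the projections to the first and the second coordinate; the sum of the
    components recovers the first one without a choice of representatives.\<close>
  have C: "C (coords s d) = coords s 0" for s d
    by (simp add: C_def sum_coords)
  have C': "C' (coords s d) = coords 0 d" for s d
    using coords_add[of s 0 0 d] by (simp add: C'_def C diff_eq_eq add.commute)
  show ?thesis
  proof (intro exI conjI allI)
    show "C (B x1, rb_compl B x2) =
      (B (B x1 + rb_compl B x2), rb_compl B (B x1 + rb_compl B x2))" for x1 x2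
      by (simp add: C_def coords_def compl_linear) (simp add: rb_compl_def)
    show "C' (B x1, rb_compl B x2) =
      (B (rb_compl B (x1 - x2)), - rb_compl B (B (x1 - x2)))" for x1 x2
      by (subst pair_eq_coords) (simp only: C', simp add: coords_def rb_compl_def B.neg B.diff)
    show "rb_lie_projection smul bracket B C"
      by (rule lie_projectionI[where \<sigma> = "\<lambda>s. s" and \<delta> = "\<lambda>_. 0"])
        (simp_all add: C descendent_bracket_zero)
    show "rb_lie_projection smul bracket B C'"
      by (rule lie_projectionI[where \<sigma> = "\<lambda>_. 0" and \<delta> = "\<lambda>d. d"])
        (simp_all add: C' bracket_zero)
    show "\<forall>p \<in> rb_bicrossed_carrier B. C p + C' p = p"
      by (simp add: C'_def)
  qed
qed

end
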